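(* Let $A,B$ be real numbers with $-1\le A<B\le 1$ and $B\neq 0$. Then $J_{A,B}\subsetneq\mathcal{C}(A,B)$, i.e. the class $J_{A,B}$ is a proper subset of the class $\mathcal{C}(A,B)$.
   Context: $\mathbb{D}=\{z\in\mathbb{C}:|z|<1\}$. $\mathcal{A}$ is the class of analytic functions $f$ on $\mathbb{D}$ with $f(0)=0$ and $f'(0)=1$. A Schwarz function is an analytic $\xi:\mathbb{D}\to\mathbb{D}$ with $\xi(0)=0$. For analytic $h,g$ on $\mathbb{D}$, $h\prec g$ ($h$ is subordinate to $g$) means that $h=g\circ\xi$ for some Schwarz function $\xi$. $J_{A,B}$ (the Janowski class) is the set of all $f\in\mathcal{A}$ for which there exists a Schwarz function $\psi$ such that $$1+\frac{zf''(z)}{f'(z)}=\frac{1+A\psi(z)}{1+B\psi(z)},\quad z\in\mathbb{D}$$ (in particular $f'$ has no zeros in $\mathbb{D}$). $\mathcal{C}(A,B)$ is the set of all analytic, locally univalent (i.e. $f'\neq 0$ everywhere) functions $f$ on $\mathbb{D}$ with $f(0)=0$, $f'(0)=1$ and $$\log f'(z)\prec\left(\frac{A}{B}-1\right)\log(1+Bz),\quad z\in\mathbb{D},$$ where $\log f'$ is the analytic branch on $\mathbb{D}$ with $\log f'(0)=0$ and $\log(1+Bz)$ is the branch vanishing at $z=0$. *)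

theory Defs
  imports "HOL-Complex_Analysis.Complex_Analysis"
begin

(* Functions on the unit disc are total functions complex => complex of which only the
   values on ball 0 1 matter: every class below is closed under changing a function outside
   the disc, so (proper) inclusions between classes mean the same as for functions on the disc. *)

abbreviation unit_disc :: "complex set" where
  "unit_disc \<equiv> ball 0 1"

definition class_A :: "(complex \<Rightarrow> complex) set" where
  "class_A = {f. f holomorphic_on unit_disc \<and> f 0 = 0 \<and> deriv f 0 = 1}"

definition schwarz_function :: "(complex \<Rightarrow> complex) \<Rightarrow> bool" where
  "schwarz_function \<xi> \<longleftrightarrow>
     \<xi> holomorphic_on unit_disc \<and> \<xi> ` unit_disc \<subseteq> unit_disc \<and> \<xi> 0 = 0"

definition subordinate :: "(complex \<Rightarrow> complex) \<Rightarrow> (complex \<Rightarrow> complex) \<Rightarrow> bool"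
    (infix "\<prec>\<^sub>D" 50) where
  "h \<prec>\<^sub>D g \<longleftrightarrow>
     h holomorphic_on unit_disc \<and> g holomorphic_on unit_disc \<and>
     (\<exists>\<xi>. schwarz_function \<xi> \<and> (\<forall>z\<in>unit_disc. h z = g (\<xi> z)))"

(* The condition deriv f z \<noteq> 0 is implicit in the quotient; it has to be stated because x / 0 = 0.
   The other denominator never vanishes when \<bar>B\<bar> \<le> 1. *)
definition janowski :: "real \<Rightarrow> real \<Rightarrow> (complex \<Rightarrow> complex) set" where
  "janowski A B = {f \<in> class_A. (\<forall>z\<in>unit_disc. deriv f z \<noteq> 0) \<and>
     (\<exists>\<psi>. schwarz_function \<psi> \<and>
        (\<forall>z\<in>unit_disc. 1 + z * deriv (deriv f) z / deriv f z =
           (1 + of_real A * \<psi> z) / (1 + of_real B * \<psi> z)))}"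

(* L is the analytic branch of log g on the disc with L 0 = 0; if g is holomorphic and zero-free
   on the disc and g 0 = 1, then L exists and its values on the disc are unique. *)
definition log_branch :: "(complex \<Rightarrow> complex) \<Rightarrow> (complex \<Rightarrow> complex) \<Rightarrow> bool" where
  "log_branch g L \<longleftrightarrow>
     L holomorphic_on unit_disc \<and> L 0 = 0 \<and> (\<forall>z\<in>unit_disc. exp (L z) = g z)"

(* For \<bar>B\<bar> \<le> 1 the values 1 + B z lie in the right half-plane, so the principal logarithm Ln
   is the analytic branch of log (1 + B z) that vanishes at 0. *)
definition class_C :: "real \<Rightarrow> real \<Rightarrow> (complex \<Rightarrow> complex) set" where
  "class_C A B = {f \<in> class_A. (\<forall>z\<in>unit_disc. deriv f z \<noteq> 0) \<and>
     (\<exists>L. log_branch (deriv f) L \<and>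
        L \<prec>\<^sub>D (\<lambda>z. (of_real A / of_real B - 1) * Ln (1 + of_real B * z)))}"

end

theory Submission
  imports Defs
begin

text \<open>
  Writing \<open>log f' = (A/B - 1) log (1 + B\<omega>)\<close>, the Janowski equation becomes
  \<open>z\<omega>' / (1 + B\<omega>) = \<psi> / (1 + B\<psi>)\<close>. At a point of minimal modulus with \<open>|\<omega>| = 1\<close>, Jack's
  lemma gives \<open>z\<omega>' = k\<omega>\<close> with \<open>k \<ge> 1\<close>, hence \<open>\<psi> (1 - (k - 1)B\<omega>) = k\<omega>\<close>. As
  \<open>|1 - (k - 1)B\<omega>| \<le> k\<close>, this contradicts \<open>|\<psi>| < 1\<close>, so \<open>\<omega>\<close> is a Schwarz function.
  For strictness take \<open>\<omega>(z) = z\<^sup>2\<close>: then \<open>\<psi> = 2z\<^sup>2 / (1 - Bz\<^sup>2)\<close>, which has modulus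
  at least 1 where \<open>z\<^sup>2 = sgn B / 2\<close>.
\<close>

section \<open>Jack's lemma\<close>

text \<open>Rescaling to \<open>\<phi> z = f (w * z) / f w\<close> moves the extremal point to 1,
  where \<open>\<phi>\<close> has value 1 and derivative \<open>d = w * deriv f w / f w\<close>.
  Comparing moduli along the radius gives \<open>Re d \<ge> 1\<close>; comparing them along the unit
  circle gives \<open>Im d = 0\<close>.\<close>

lemma jack_lemma:
  assumes hol: "f holomorphic_on ball 0 1" and f0: "f 0 = 0"
    and w: "w \<in> ball 0 1"
    and nz: "f w \<noteq> 0"
    and less: "\<And>z. norm z < norm w \<Longrightarrow> norm (f z) < norm (f w)"
  obtains k :: real where "k \<ge> 1" "w * deriv f w = of_real k * f w"
proof -
  define \<phi> where "\<phi> z = f (w * z) / f w" for z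
  define d where "d = w * deriv f w / f w"
  have w_nz: "w \<noteq> 0"
    using f0 nz by auto
  have "(f has_field_derivative deriv f w) (at (w * 1))"
    using holomorphic_derivI[OF hol _ w] by simp
  then have \<phi>': "(\<phi> has_field_derivative d) (at 1)"
    unfolding \<phi>_def d_def
    using nz by (auto intro!: derivative_eq_intros DERIV_chain2[where f = f])
  have inside: "w * z \<in> ball 0 1" if "norm z \<le> 1" for z
    using w that mult_left_le[of "norm z" "norm w"] by (auto simp: norm_mult)
  have hol_\<phi>: "\<phi> holomorphic_on cball 0 1"
    unfolding \<phi>_def
    by (intro holomorphic_intros holomorphic_on_compose_gen[OF _ hol, unfolded o_def])
       (use inside nz in auto)
  have \<phi>_lt: "norm (\<phi> z) < 1" if "norm z < 1" for z
    using less[of "w * z"] that w_nz nz by (simp add: \<phi>_def norm_divide norm_mult)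
  have "\<phi> holomorphic_on ball 0 1"
    using hol_\<phi> by (rule holomorphic_on_subset) auto
  then have schwarz: "norm (\<phi> z) \<le> norm z" if "norm z < 1" for z
    using Schwarz_Lemma(1)[of \<phi> z] \<phi>_lt that f0 by (simp add: \<phi>_def)
  \<comment> \<open>The assumption \<open>less\<close> covers only the open disc; continuity carries
    the weak bound to the circle, where the tangential argument needs it.\<close>
  have \<phi>_le: "norm (\<phi> z) \<le> 1" if "norm z \<le> 1" for z
  proof (rule continuous_on_closure_norm_le[of "ball 0 1" \<phi>])
    show "\<forall>y\<in>ball 0 1. norm (\<phi> y) \<le> 1"
      using \<phi>_lt by (auto simp: less_imp_le)
  qed (use that holomorphic_on_imp_continuous_on[OF hol_\<phi>] in auto)
  have \<phi>1: "\<phi> 1 = 1"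
    using nz by (simp add: \<phi>_def)
  \<comment> \<open>Otherwise \<open>Re (\<phi> t) - t\<close>, which vanishes at
    \<open>t = 1\<close>, would be positive for \<open>t\<close> slightly below 1, against the
    Schwarz bound on \<open>\<phi> t\<close>.\<close>
  have "Re d \<ge> 1"
  proof (rule ccontr)
    assume "\<not> Re d \<ge> 1"
    have "((\<lambda>t. Re (\<phi> (of_real t)) - t) has_real_derivative Re d - 1) (at 1)"
      using \<phi>' by (auto intro!: derivative_eq_intros has_vector_derivative_real_field has_field_derivative_Re)
    from DERIV_neg_dec_left[OF this] \<open>\<not> Re d \<ge> 1\<close> obtain e where e: "e > 0"
      "\<And>h. 0 < h \<Longrightarrow> h < e \<Longrightarrow> Re (\<phi> 1) - 1 < Re (\<phi> (of_real (1 - h))) - (1 - h)"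
      by auto
    define h where "h = min e 1 / 2"
    have h: "0 < h" "h < e" "h < 1" using e by (auto simp: h_def min_def)
    have "norm (\<phi> (of_real (1 - h))) \<le> 1 - h"
      using schwarz[of "of_real (1 - h)"] h by (simp only: norm_of_real) auto
    then show False
      using e(2)[OF h(1,2)] complex_Re_le_cmod[of "\<phi> (of_real (1 - h))"] \<phi>1 by simp
  qed
  \<comment> \<open>The function \<open>Re (\<phi> (cis s))\<close> never exceeds 1 and equals 1 at
    \<open>s = 0\<close>, so its derivative there, \<open>- Im d\<close>, vanishes.\<close>
  have "((\<lambda>s. Re (\<phi> (cis s))) has_real_derivative Re (\<i> * d)) (at 0)"
  proof -
    have "(cis has_vector_derivative \<i>) (at 0)"
      by (auto simp: has_vector_derivative_complex_iff intro!: derivative_eq_intros)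
    then show ?thesis
      using field_vector_diff_chain_at[of cis \<i> 0 \<phi> d] \<phi>'
      by (intro has_field_derivative_Re) (simp add: o_def)
  qed
  then have "Re (\<i> * d) = 0"
    by (rule DERIV_local_max[where d = 1])
       (use \<phi>1 in \<open>auto intro!: order_trans[OF complex_Re_le_cmod] \<phi>_le\<close>)
  then have "d = of_real (Re d)"
    by (simp add: complex_eq_iff)
  then have "w * deriv f w = of_real (Re d) * f w"
    using nz by (metis d_def nonzero_divide_eq_eq)
  with \<open>Re d \<ge> 1\<close> show thesis
    by (rule that)
qed

section \<open>Branches of the logarithm on the disc\<close>

lemma one_plus_right_half_plane:
  fixes B :: real
  assumes "\<bar>B\<bar> \<le> 1" "norm z < 1"
  shows "Re (1 + of_real B * z) > 0" "1 + of_real B * z \<noteq> 0"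
proof -
  have "norm (of_real B * z) < 1"
    using assms mult_right_mono[of "\<bar>B\<bar>" 1 "norm z"] by (simp add: norm_mult)
  then show "Re (1 + of_real B * z) > 0"
    using abs_Re_le_cmod[of "of_real B * z"] by simp
  then show "1 + of_real B * z \<noteq> 0"
    by (metis less_irrefl zero_complex.simps(1))
qed

lemma holomorphic_Ln_one_plus:
  fixes B :: real
  assumes "\<bar>B\<bar> \<le> 1" "g holomorphic_on S" "\<And>z. z \<in> S \<Longrightarrow> norm (g z) < 1"
  shows "(\<lambda>z. Ln (1 + of_real B * g z)) holomorphic_on S"
  using assms one_plus_right_half_plane(1)[OF assms(1)]
  by (intro holomorphic_intros) (auto simp: complex_nonpos_Reals_iff not_le)

lemma log_branch_nonzero:
  assumes "log_branch g L" "z \<in> unit_disc"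
  shows "g z \<noteq> 0"
  using assms by (auto simp: log_branch_def dest!: bspec[of _ _ z])

lemma log_branch_has_derivative:
  assumes L: "log_branch g L" and z: "z \<in> unit_disc"
  shows "(L has_field_derivative deriv g z / g z) (at z)"
proof -
  have hol: "L holomorphic_on unit_disc" and exp_eq: "\<And>u. u \<in> unit_disc \<Longrightarrow> exp (L u) = g u"
    using L by (auto simp: log_branch_def)
  have dL: "(L has_field_derivative deriv L z) (at z)"
    using holomorphic_derivI[OF hol] z by auto
  then have "((\<lambda>u. exp (L u)) has_field_derivative g z * deriv L z) (at z)"
    using exp_eq[OF z] by (auto intro!: derivative_eq_intros)
  then have "(g has_field_derivative g z * deriv L z) (at z)"
    by (rule has_field_derivative_transform_within_open[of _ _ _ unit_disc]) (use exp_eq z in auto)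
  then have "deriv g z = g z * deriv L z"
    by (rule DERIV_imp_deriv)
  then show ?thesis
    using dL log_branch_nonzero[OF L z] by simp
qed

text \<open>Both branches have derivative \<open>g' / g\<close>, so their difference is constant,
  and it vanishes at 0.\<close>

lemma log_branch_unique:
  assumes L: "log_branch g L" and M: "log_branch g M" and z: "z \<in> unit_disc"
  shows "L z = M z"
proof -
  note der = log_branch_has_derivative
  have "\<exists>c. \<forall>u\<in>unit_disc. L u - M u = c"
    by (rule has_field_derivative_zero_constant)
       (auto intro!: derivative_eq_intros
          has_field_derivative_at_within[OF der[OF L]] has_field_derivative_at_within[OF der[OF M]])
  moreover have "L 0 - M 0 = 0"
    using L M by (simp add: log_branch_def)
  ultimately have "L z - M z = 0"
    using z by (metis centre_in_ball zero_less_one)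
  then show ?thesis
    by simp
qed

lemma log_branch_exists:
  assumes "g holomorphic_on unit_disc" "g 0 = 1" "\<And>z. z \<in> unit_disc \<Longrightarrow> g z \<noteq> 0"
  obtains L where "log_branch g L"
proof -
  obtain M where M: "M holomorphic_on unit_disc" "\<And>z. z \<in> unit_disc \<Longrightarrow> g z = exp (M z)"
    using contractible_imp_holomorphic_log[OF assms(1) _ assms(3)]
    by (auto intro: convex_imp_contractible)
  \<comment> \<open>The shift leaves the exponential unchanged because
    \<open>exp (M 0) = g 0 = 1\<close>.\<close>
  have "log_branch g (\<lambda>z. M z - M 0)"
    using M M(2)[of 0] assms(2)
    by (auto simp: log_branch_def exp_diff intro!: holomorphic_intros)
  then show thesis
    by (rule that)
qed

section \<open>The Janowski condition in terms of \<open>\<omega>\<close>\<close>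

text \<open>This is the logarithmic derivative of \<open>g = (1 + B \<omega>)^(A/B - 1)\<close>,
  with \<open>(A/B - 1) B = A - B\<close>. The relation is assumed in exponential form so that it
  applies before \<open>\<omega>\<close> is known to be bounded by 1, when
  \<open>Ln (1 + B \<omega>)\<close> could still meet the branch cut.\<close>

lemma janowski_quotient:
  fixes A B :: real
  assumes L: "log_branch g L" and \<omega>: "\<omega> holomorphic_on unit_disc"
    and exp_eq: "\<And>u. u \<in> unit_disc \<Longrightarrow> exp (L u / (of_real A / of_real B - 1)) = 1 + of_real B * \<omega> u"
    and AB: "A \<noteq> B" "B \<noteq> 0" and z: "z \<in> unit_disc"
  shows "z * deriv g z / g z =
    (of_real A - of_real B) * (z * deriv \<omega> z) / (1 + of_real B * \<omega> z)"
proof -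
  let ?c = "of_real A / of_real B - 1 :: complex"
  have c: "?c \<noteq> 0"
    using AB by simp
  have dL: "(L has_field_derivative deriv L z) (at z)" and dg: "deriv L z = deriv g z / g z"
    using log_branch_has_derivative[OF L z] DERIV_imp_deriv by fastforce+
  have d\<omega>: "(\<omega> has_field_derivative deriv \<omega> z) (at z)"
    using holomorphic_derivI[OF \<omega>] z by auto
  have nz: "1 + of_real B * \<omega> z \<noteq> 0"
    using exp_eq[OF z] by (metis exp_not_eq_zero)
  have "((\<lambda>u. exp (L u / ?c)) has_field_derivative exp (L z / ?c) * (deriv L z / ?c)) (at z)"
    by (rule DERIV_fun_exp[OF DERIV_cdivide[OF dL]])
  then have "((\<lambda>u. 1 + of_real B * \<omega> u) has_field_derivative exp (L z / ?c) * (deriv L z / ?c)) (at z)"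
    by (rule has_field_derivative_transform_within_open[of _ _ _ unit_disc]) (use exp_eq z in auto)
  moreover have "((\<lambda>u. 1 + of_real B * \<omega> u) has_field_derivative of_real B * deriv \<omega> z) (at z)"
    using d\<omega> by (auto intro!: derivative_eq_intros)
  ultimately have "(1 + of_real B * \<omega> z) * (deriv L z / ?c) = of_real B * deriv \<omega> z"
    using DERIV_unique exp_eq[OF z] by metis
  then have "(1 + of_real B * \<omega> z) * deriv L z = ?c * of_real B * deriv \<omega> z"
    using c by (simp add: field_simps)
  moreover have "?c * of_real B = of_real A - of_real B"
    using AB by (simp add: field_simps)
  ultimately have "deriv L z = (of_real A - of_real B) * deriv \<omega> z / (1 + of_real B * \<omega> z)"
    using nz by (simp add: field_simps)
  then show ?thesis
    using dg by (metis mult.left_commute times_divide_eq_right)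
qed

text \<open>After clearing denominators, the difference of the two sides has the factor
  \<open>a - b\<close>. In use, \<open>x\<close>, \<open>d\<close>, \<open>p\<close> are the values
  of \<open>\<omega>\<close>, \<open>z \<omega>'\<close> and \<open>\<psi>\<close> at a point; the
  conclusion is \<open>d / (1 + b x) = p / (1 + b p)\<close> without division.\<close>

lemma janowski_equation:
  fixes a b x p d :: complex
  assumes "1 + (a - b) * d / (1 + b * x) = (1 + a * p) / (1 + b * p)"
    and "1 + b * x \<noteq> 0" "1 + b * p \<noteq> 0" "a \<noteq> b"
  shows "p * (1 + b * x - b * d) = d"
proof -
  have "(1 + b * x + (a - b) * d) / (1 + b * x) = (1 + a * p) / (1 + b * p)"
    using assms(1,2) by (simp add: add_divide_distrib[of "1 + b * x"])
  then have "(1 + b * x + (a - b) * d) * (1 + b * p) = (1 + a * p) * (1 + b * x)"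
    by (simp only: frac_eq_eq[OF assms(2,3)])
  then have "(a - b) * (p * (1 + b * x - b * d) - d) = 0"
    by algebra
  then show ?thesis
    using assms(4) by simp
qed

section \<open>The inclusion\<close>

lemma janowski_subset_class_C:
  fixes A B :: real
  assumes "A \<noteq> B" "B \<noteq> 0" "\<bar>B\<bar> \<le> 1"
  shows "janowski A B \<subseteq> class_C A B"
proof
  fix f assume "f \<in> janowski A B"
  then obtain \<psi> where f: "f \<in> class_A" and nz: "\<And>z. z \<in> unit_disc \<Longrightarrow> deriv f z \<noteq> 0"
    and \<psi>: "schwarz_function \<psi>"
    and eq: "\<And>z. z \<in> unit_disc \<Longrightarrow> 1 + z * deriv (deriv f) z / deriv f z =
           (1 + of_real A * \<psi> z) / (1 + of_real B * \<psi> z)"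
    unfolding janowski_def by blast
  let ?c = "of_real A / of_real B - 1 :: complex"
  have c: "?c \<noteq> 0"
    using assms by simp
  have "deriv f holomorphic_on unit_disc" "deriv f 0 = 1"
    using f by (auto simp: class_A_def intro: holomorphic_deriv)
  from log_branch_exists[OF this nz] obtain L where L: "log_branch (deriv f) L"
    by auto
  then have holL: "L holomorphic_on unit_disc" and L0: "L 0 = 0"
    by (auto simp: log_branch_def)
  \<comment> \<open>Solving \<open>(A/B - 1) log (1 + B \<omega>) = log f'\<close> for
    \<open>\<omega>\<close> by exponentiation gives a function holomorphic on the whole disc; only
    its bound by 1 remains to be shown.\<close>
  define \<omega> where "\<omega> z = (exp (L z / ?c) - 1) / of_real B" for z
  have hol\<omega>: "\<omega> holomorphic_on unit_disc"
    unfolding \<omega>_def using assms c by (intro holomorphic_intros holL) auto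
  have \<omega>0: "\<omega> 0 = 0"
    by (simp add: \<omega>_def L0)
  have exp_eq: "exp (L z / ?c) = 1 + of_real B * \<omega> z" for z
    using assms by (simp add: \<omega>_def)
  have key: "\<psi> z * (1 + of_real B * \<omega> z - of_real B * (z * deriv \<omega> z)) = z * deriv \<omega> z"
    if "z \<in> unit_disc" for z
  proof (rule janowski_equation)
    show "1 + (of_real A - of_real B) * (z * deriv \<omega> z) / (1 + of_real B * \<omega> z)
        = (1 + of_real A * \<psi> z) / (1 + of_real B * \<psi> z)"
      using janowski_quotient[OF L hol\<omega> exp_eq assms(1,2) that] eq[OF that] by simp
    show "1 + of_real B * \<omega> z \<noteq> 0"
      using exp_eq[of z] by (metis exp_not_eq_zero)
    show "1 + of_real B * \<psi> z \<noteq> 0"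
      using one_plus_right_half_plane(2)[OF assms(3)] \<psi> that by (force simp: schwarz_function_def)
  qed (use assms in auto)
  have \<omega>_lt: "norm (\<omega> z) < 1" if "z \<in> unit_disc" for z
  proof (rule ccontr)
    assume "\<not> norm (\<omega> z) < 1"
    \<comment> \<open>A point of the closed set \<open>K\<close> nearest to 0 is a first point where
      \<open>\<omega>\<close> leaves the open unit disc: every point of smaller modulus has
      \<open>norm (\<omega> u) < 1\<close>.\<close>
    define K where "K = {u \<in> cball 0 (norm z). 1 \<le> norm (\<omega> u)}"
    have sub: "cball 0 (norm z) \<subseteq> unit_disc"
      using that by auto
    have cont: "continuous_on (cball 0 (norm z)) \<omega>"
      using holomorphic_on_imp_continuous_on[OF hol\<omega>] continuous_on_subset sub by blast
    have "K = cball 0 (norm z) \<inter> \<omega> -` (- ball 0 1)"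
      by (auto simp: K_def)
    then have "closed K"
      using continuous_closed_preimage[OF cont, of "- ball 0 1"] by (simp add: closed_Compl)
    moreover have "K \<noteq> {}"
      using \<open>\<not> norm (\<omega> z) < 1\<close> by (auto simp: K_def)
    ultimately obtain w where w: "w \<in> K" and min: "\<And>u. u \<in> K \<Longrightarrow> norm w \<le> norm u"
      using distance_attains_inf[of K 0] by auto
    have wz: "norm w \<le> norm z" and w1: "norm (\<omega> w) \<ge> 1"
      using w by (auto simp: K_def)
    have w_disc: "w \<in> unit_disc"
      using wz that by auto
    have w0: "w \<noteq> 0"
      using w1 \<omega>0 by auto
    have below: "norm (\<omega> u) < 1" if "norm u < norm w" for u
      using min[of u] that wz by (force simp: K_def)
    \<comment> \<open>Since \<open>w \<noteq> 0\<close>, the point \<open>w\<close> lies in the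
      closure of the ball of radius \<open>norm w\<close>, so the bound inside passes to
      \<open>w\<close> by continuity.\<close>
    have "norm (\<omega> w) \<le> 1"
    proof (rule continuous_on_closure_norm_le[of "ball 0 (norm w)" \<omega>])
      show "\<forall>y\<in>ball 0 (norm w). norm (\<omega> y) \<le> 1"
        using below by (auto simp: less_imp_le)
    qed (use w0 wz continuous_on_subset[OF cont] in \<open>auto simp: subset_eq\<close>)
    with w1 have \<omega>w: "norm (\<omega> w) = 1"
      by simp
    then have "\<omega> w \<noteq> 0" and "\<And>u. norm u < norm w \<Longrightarrow> norm (\<omega> u) < norm (\<omega> w)"
      using below by auto
    then obtain k :: real where k: "k \<ge> 1" "w * deriv \<omega> w = of_real k * \<omega> w"
      using jack_lemma[OF hol\<omega> \<omega>0 w_disc] by blast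
    have "1 + of_real B * \<omega> w - of_real B * (of_real k * \<omega> w) = 1 - of_real ((k - 1) * B) * \<omega> w"
      by (simp add: algebra_simps)
    then have "\<psi> w * (1 - of_real ((k - 1) * B) * \<omega> w) = of_real k * \<omega> w"
      using key[OF w_disc] k by metis
    then have "norm (\<psi> w * (1 - of_real ((k - 1) * B) * \<omega> w)) = norm (of_real k * \<omega> w)"
      by (rule arg_cong)
    then have "norm (\<psi> w) * norm (1 - of_real ((k - 1) * B) * \<omega> w) = k"
      using k \<omega>w by (simp only: norm_mult norm_of_real)
    \<comment> \<open>Here \<open>k \<ge> 1\<close> and \<open>\<bar>B\<bar> \<le> 1\<close> enter:
      the triangle inequality gives at most \<open>1 + (k - 1) \<bar>B\<bar>\<close>.\<close>
    moreover have "norm (1 - of_real ((k - 1) * B) * \<omega> w) \<le> k"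
    proof -
      have "norm (1 - of_real ((k - 1) * B) * \<omega> w) \<le> 1 + norm (of_real ((k - 1) * B) * \<omega> w)"
        by (rule order_trans[OF norm_triangle_ineq4]) simp
      also have "norm (of_real ((k - 1) * B) * \<omega> w) = (k - 1) * \<bar>B\<bar>"
        using k \<omega>w by (simp only: norm_mult norm_of_real abs_mult)
      also have "\<dots> \<le> k - 1"
        using k assms by (simp add: mult_left_le)
      finally show ?thesis
        by simp
    qed
    moreover have "norm (\<psi> w) < 1"
      using \<psi> w_disc by (force simp: schwarz_function_def)
    ultimately show False
      using k mult_left_mono[of _ k "norm (\<psi> w)"] mult_strict_right_mono[of "norm (\<psi> w)" 1 k]
      by fastforce
  qed
  have schwarz: "schwarz_function \<omega>"
    using hol\<omega> \<omega>0 \<omega>_lt by (auto simp: schwarz_function_def)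
  \<comment> \<open>Uniqueness of the branch excludes a multiple of \<open>2 \<pi> i\<close> between
    \<open>L / ?c\<close> and the principal logarithm, which is holomorphic here because
    \<open>\<omega>\<close> is now bounded by 1.\<close>
  have "log_branch (\<lambda>z. 1 + of_real B * \<omega> z) (\<lambda>z. L z / ?c)"
    using exp_eq c by (auto simp: log_branch_def L0 intro!: holomorphic_intros holL)
  moreover have "log_branch (\<lambda>z. 1 + of_real B * \<omega> z) (\<lambda>z. Ln (1 + of_real B * \<omega> z))"
    using \<omega>_lt one_plus_right_half_plane(2)[OF assms(3)] \<omega>0
    by (auto simp: log_branch_def intro!: holomorphic_Ln_one_plus assms hol\<omega>)
  ultimately have "L z / ?c = Ln (1 + of_real B * \<omega> z)" if "z \<in> unit_disc" for z
    using log_branch_unique that by blast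
  then have "L z = ?c * Ln (1 + of_real B * \<omega> z)" if "z \<in> unit_disc" for z
    using c that by (metis nonzero_mult_div_cancel_left times_divide_eq_right)
  moreover have "(\<lambda>z. ?c * Ln (1 + of_real B * z)) holomorphic_on unit_disc"
    using holomorphic_Ln_one_plus[of B "\<lambda>z. z" unit_disc] assms
    by (auto intro!: holomorphic_intros)
  ultimately have "L \<prec>\<^sub>D (\<lambda>z. ?c * Ln (1 + of_real B * z))"
    using schwarz holL by (auto simp: subordinate_def)
  then show "f \<in> class_C A B"
    using f nz L by (auto simp: class_C_def)
qed

section \<open>Strictness of the inclusion\<close>

lemma class_C_not_subset_janowski:
  fixes A B :: real
  assumes "A \<noteq> B" "B \<noteq> 0" "\<bar>B\<bar> \<le> 1"
  shows "\<exists>f. f \<in> class_C A B \<and> f \<notin> janowski A B"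
proof -
  let ?c = "of_real A / of_real B - 1 :: complex"
  have c: "?c \<noteq> 0"
    using assms by simp
  have sq_lt: "norm (z\<^sup>2) < 1" if "z \<in> unit_disc" for z :: complex
    using that by (simp add: norm_power power_less_one_iff)
  \<comment> \<open>This is \<open>log f'\<close> for the Schwarz function \<open>z\<^sup>2\<close>;
    the function \<open>f\<close> itself is recovered as the primitive of \<open>exp L\<close>
    vanishing at 0.\<close>
  define L where "L z = ?c * Ln (1 + of_real B * z\<^sup>2)" for z
  have holL: "L holomorphic_on unit_disc"
    unfolding L_def using assms sq_lt
    by (intro holomorphic_intros holomorphic_Ln_one_plus) auto
  have "(\<lambda>z. exp (L z)) holomorphic_on unit_disc"
    by (intro holomorphic_intros holL)
  then have "\<exists>h. \<forall>z\<in>unit_disc. (h has_field_derivative exp (L z)) (at z within unit_disc)"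
    by (rule holomorphic_convex_primitive'[OF convex_ball open_ball]) blast
  then obtain h where h: "\<And>z. z \<in> unit_disc \<Longrightarrow> (h has_field_derivative exp (L z)) (at z within unit_disc)"
    by metis
  define f where "f z = h z - h 0" for z
  have df: "(f has_field_derivative exp (L z)) (at z)" if "z \<in> unit_disc" for z
  proof -
    have "(h has_field_derivative exp (L z)) (at z)"
      using h[OF that] by (simp only: at_within_open[OF that open_ball])
    then show ?thesis
      unfolding f_def using DERIV_diff[OF _ DERIV_const] by force
  qed
  have deriv_f: "deriv f z = exp (L z)" if "z \<in> unit_disc" for z
    using df[OF that] by (rule DERIV_imp_deriv)
  have "f holomorphic_on unit_disc"
    using df holomorphic_on_open by blast
  then have f_A: "f \<in> class_A"
    using deriv_f by (simp add: class_A_def f_def L_def)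
  have branch: "log_branch (deriv f) L"
    using holL deriv_f by (auto simp: log_branch_def L_def)
  have "schwarz_function (\<lambda>z. z\<^sup>2)"
    using sq_lt by (auto simp: schwarz_function_def intro!: holomorphic_intros)
  moreover have "(\<lambda>z. ?c * Ln (1 + of_real B * z)) holomorphic_on unit_disc"
    using holomorphic_Ln_one_plus[of B "\<lambda>z. z" unit_disc] assms
    by (auto intro!: holomorphic_intros)
  ultimately have "L \<prec>\<^sub>D (\<lambda>z. ?c * Ln (1 + of_real B * z))"
    unfolding subordinate_def using holL L_def by blast
  then have "f \<in> class_C A B"
    using f_A branch deriv_f by (auto simp: class_C_def)
  moreover have "f \<notin> janowski A B"
  proof
    assume "f \<in> janowski A B"
    then obtain \<psi> where \<psi>: "schwarz_function \<psi>"
      and eq: "\<And>z. z \<in> unit_disc \<Longrightarrow> 1 + z * deriv (deriv f) z / deriv f z =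
           (1 + of_real A * \<psi> z) / (1 + of_real B * \<psi> z)"
      unfolding janowski_def by blast
    \<comment> \<open>This choice makes \<open>B z\<^sup>2 = \<bar>B\<bar> / 2\<close> for either
      sign of \<open>B\<close>. The factor multiplying \<open>\<psi> z\<close> then becomes the real
      number \<open>1 - \<bar>B\<bar> / 2\<close>, between 0 and 1, while \<open>2 z\<^sup>2\<close>
      has modulus 1.\<close>
    define z where "z = csqrt (of_real (sgn B / 2))"
    have z2: "z\<^sup>2 = of_real (sgn B / 2)"
      by (simp add: z_def)
    have "norm z ^ 2 = 1 / 2"
      using assms by (simp only: norm_power[symmetric] z2 norm_of_real) (simp add: abs_sgn_eq)
    then have "norm z ^ 2 < 1"
      by simp
    then have z: "z \<in> unit_disc"
      by (simp add: power_less_one_iff)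
    have exp_eq: "exp (L u / ?c) = 1 + of_real B * u\<^sup>2" if "u \<in> unit_disc" for u
      using one_plus_right_half_plane(2)[OF assms(3) sq_lt[OF that]] c by (simp add: L_def)
    have "(\<lambda>z::complex. z\<^sup>2) holomorphic_on unit_disc"
      by (intro holomorphic_intros)
    \<comment> \<open>With \<open>\<omega> z = z\<^sup>2\<close> the term \<open>z \<omega>'\<close>
      is \<open>2 z\<^sup>2\<close>.\<close>
    from janowski_quotient[OF branch this exp_eq assms(1,2) z]
    have q: "z * deriv (deriv f) z / deriv f z
        = (of_real A - of_real B) * (2 * z\<^sup>2) / (1 + of_real B * z\<^sup>2)"
      by (simp add: power2_eq_square)
    have \<psi>z: "norm (\<psi> z) < 1"
      using \<psi> z by (force simp: schwarz_function_def)
    have "1 + of_real B * z\<^sup>2 - of_real B * (2 * z\<^sup>2) = of_real (1 - \<bar>B\<bar> / 2)"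
      using z2 by (simp add: abs_sgn)
    moreover have "\<psi> z * (1 + of_real B * z\<^sup>2 - of_real B * (2 * z\<^sup>2)) = 2 * z\<^sup>2"
      using one_plus_right_half_plane(2)[OF assms(3) sq_lt[OF z]] one_plus_right_half_plane(2)[OF assms(3) \<psi>z]
        eq[OF z] q assms(1)
      by (intro janowski_equation[of "of_real A"]) auto
    ultimately have "\<psi> z * of_real (1 - \<bar>B\<bar> / 2) = 2 * z\<^sup>2"
      by (simp only:)
    also have "2 * z\<^sup>2 = of_real (sgn B)"
      unfolding z2 by simp
    finally have "norm (\<psi> z * of_real (1 - \<bar>B\<bar> / 2)) = norm (of_real (sgn B) :: complex)"
      by (rule arg_cong)
    then have "norm (\<psi> z) * (1 - \<bar>B\<bar> / 2) = 1"
      using assms by (simp only: norm_mult norm_of_real) (simp add: abs_sgn_eq)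
    moreover have "norm (\<psi> z) * (1 - \<bar>B\<bar> / 2) \<le> norm (\<psi> z)"
      using assms by (intro mult_left_le) auto
    ultimately show False
      using \<psi>z by simp
  qed
  ultimately show ?thesis
    by blast
qed

theorem mainTheorem2:
  fixes A B :: real
  assumes "-1 \<le> A" and "A < B" and "B \<le> 1" and "B \<noteq> 0"
  shows "janowski A B \<subset> class_C A B"
proof -
  have "A \<noteq> B" "\<bar>B\<bar> \<le> 1"
    using assms by auto
  then show ?thesis
    using janowski_subset_class_C class_C_not_subset_janowski assms(4) by blast
qed

end
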